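(* For every $n\in\mathbb{Z}_{\geq0}$ and every even $k\in\mathbb{Z}_+$, \[|\mathcal{M}_{n}^{(k)}|=\sum_{i=0}^{2n}(-1)^{i}\mu_i\mu_{2n-i},\qquad\text{where}\qquad \mu_n=\frac1{(k+1)n+1}\sum_{i=0}^{\lfloor n/2\rfloor}\binom{\frac {(k+1)n+1}2}{n-i}\binom{n-i}{i}.\]
   Context: For even $k\in\mathbb{Z}_+$, $\mathcal{M}_n^{(k)}$ (the $k$-Motzkin paths of size $n$) is the set of lattice paths from $(0,0)$ to $((k+1)n,0)$ with step set $\{(1,2k),(1,k-1),(1,-2)\}$ that never go below the $x$-axis. The binomial coefficient is the generalised one: $\binom{\alpha}{j}=\frac1{j!}\prod_{t=0}^{j-1}(\alpha-t)$ for $\alpha\in\mathbb{C}$, $j\in\mathbb{Z}_{\geq0}$. *)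

theory Defs
  imports Complex_Main "HOL-Library.Product_Plus"
begin

definition motzkin_steps :: "nat \<Rightarrow> (int \<times> int) set" where
  "motzkin_steps k = {(1, 2 * int k), (1, int k - 1), (1, - 2)}"

text \<open>A lattice path starting at the origin is encoded by its list of steps; the vertex it
  reaches after \<open>j\<close> steps is the componentwise sum of the first \<open>j\<close> of them.  As the path is
  linear between consecutive vertices, it stays weakly above the \<open>x\<close>-axis iff all its vertices do.\<close>

definition vertex :: "(int \<times> int) list \<Rightarrow> nat \<Rightarrow> int \<times> int" where
  "vertex p j = sum_list (take j p)"

definition motzkin_paths :: "nat \<Rightarrow> nat \<Rightarrow> (int \<times> int) list set" where
  "motzkin_paths k n =
     {p. set p \<subseteq> motzkin_steps k \<and>
         vertex p (length p) = ((int k + 1) * int n, 0) \<and>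
         (\<forall>j\<le>length p. 0 \<le> snd (vertex p j))}"

text \<open>The upper argument \<open>((k + 1) n + 1) / 2\<close> is a half-integer in general, hence the use
  of the generalised binomial coefficient over the reals.\<close>

definition mu :: "nat \<Rightarrow> nat \<Rightarrow> real" where
  "mu k n = 1 / ((real k + 1) * real n + 1) *
     (\<Sum>i = 0..n div 2. ((((real k + 1) * real n + 1) / 2) gchoose (n - i)) *
                        (real (n - i) gchoose i))"

end

theory Submission
  imports Defs "HOL-Computational_Algebra.Formal_Power_Series"
begin

text \<open>
  Put \<open>\<phi>(z) = (1 + z + z\<^sup>2)\<^bsup>1/2\<^esup>\<close>. Expanding \<open>(1 + z(1 + z))\<^bsup>m/2\<^esup>\<close> with \<open>m = (k + 1)n + 1\<close>
  shows that \<open>\<mu>\<^sub>n\<close> is \<open>1/m\<close> times the coefficient of \<open>z\<^sup>n\<close> in \<open>\<phi>\<^sup>m\<close>, so by Lagrange inversion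
  \<open>B(x) = \<Sum> \<mu>\<^sub>n x\<^sup>n\<close> satisfies \<open>B\<^sup>2 = 1 + w + w\<^sup>2\<close> where \<open>w = x B\<^bsup>k+1\<^esup>\<close>.
  Let \<open>s\<close> be a square root of the variable that marks steps. As \<open>k\<close> is even,
  \<open>u = s B(s\<^bsup>k+1\<^esup>)\<close> and \<open>v = -s B(-s\<^bsup>k+1\<^esup>)\<close> are the two small roots of the kernel equation
  \<open>u\<^sup>2 = s\<^sup>2 (1 + u\<^bsup>k+1\<^esup> + u\<^bsup>2k+2\<^esup>)\<close>. The generating function of the paths from height \<open>h\<close> to
  height \<open>0\<close> is \<open>B(s\<^bsup>k+1\<^esup>) B(-s\<^bsup>k+1\<^esup>) (u\<^bsup>h+1\<^esup> - v\<^bsup>h+1\<^esup>) / (u - v)\<close>, because this expression obeys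
  the recurrence on the first step that determines the path numbers. The theorem is the case
  \<open>h = 0\<close>.
\<close>

unbundle fps_syntax

section \<open>Lagrange inversion\<close>

text \<open>For \<open>d > 0\<close>, \<open>fps_deriv p * p ^ (d - 1)\<close> is the derivative of
  \<open>p ^ d\<close> divided by \<open>d\<close>. Multiplied by \<open>fps_X\<close>, it has the
  same coefficient at \<open>d\<close> as \<open>p ^ d\<close>, and the two cancel.\<close>

lemma fps_nth_power_mult_log_deriv:
  fixes p :: "'a :: field_char_0 fps"
  assumes p0: "p $ 0 \<noteq> 0"
  shows "(p ^ d * (1 - fps_X * fps_deriv p * inverse p)) $ d = (if d = 0 then 1 else 0)"
proof (cases d)
  case (Suc e)
  have "inverse p * p = 1"
    using p0 by (rule inverse_mult_eq_1)
  then have "p ^ d * (1 - fps_X * fps_deriv p * inverse p) =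
      p ^ d - fps_X * (fps_deriv p * p ^ e)"
    by (simp add: Suc right_diff_distrib mult_ac)
  moreover have "of_nat d * (fps_deriv p * p ^ e) = fps_deriv (p ^ d)"
    unfolding Suc fps_deriv_power' by (simp add: mult_ac del: of_nat_Suc)
  then have "of_nat d * (fps_deriv p * p ^ e) $ e = of_nat d * (p ^ d $ d)"
    by (metis Suc Suc_eq_plus1 fps_deriv_nth fps_of_nat fps_mult_left_const_nth)
  then have "(fps_deriv p * p ^ e) $ e = p ^ d $ d"
    by (simp add: Suc del: of_nat_Suc)
  ultimately show ?thesis
    by (simp add: Suc)
qed simp

lemma fps_nth_compose_mult:
  fixes a c g :: "'a :: comm_ring_1 fps"
  assumes "c $ 0 = 0"
  shows "((a oo c) * g) $ n = (\<Sum>j=0..n. a $ j * (c ^ j * g) $ n)"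
proof -
  \<comment> \<open>As \<open>c ^ j\<close> starts in degree at least \<open>j\<close>, the
    summation range can be the same for all \<open>l \<le> n\<close>, which permits the swap
    below.\<close>
  have "(a oo c) $ l = (\<Sum>j=0..n. a $ j * c ^ j $ l)" if "l \<le> n" for l
    unfolding fps_compose_nth using that startsby_zero_power_prefix[OF assms]
    by (intro sum.mono_neutral_left) auto
  then have "((a oo c) * g) $ n = (\<Sum>l=0..n. \<Sum>j=0..n. a $ j * c ^ j $ l * g $ (n - l))"
    unfolding fps_mult_nth by (intro sum.cong refl) (simp add: sum_distrib_right)
  also have "\<dots> = (\<Sum>j=0..n. \<Sum>l=0..n. a $ j * c ^ j $ l * g $ (n - l))"
    by (rule sum.swap)
  finally show ?thesis
    by (simp add: fps_mult_nth sum_distrib_left mult.assoc)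
qed

text \<open>With \<open>f\<close> and \<open>q\<close> as below, the coefficient of
  \<open>f ^ j * p ^ n * q\<close> at \<open>n\<close> is that of \<open>p ^ (n - j) * q\<close> at
  \<open>n - j\<close>, a Kronecker delta. It extracts \<open>b $ n\<close> from the expansion of
  \<open>b oo f\<close>.\<close>

lemma fps_Lagrange_inversion:
  fixes b p :: "'a :: field_char_0 fps"
  assumes p0: "p $ 0 \<noteq> 0"
  shows "b $ n = ((b oo (fps_X * inverse p)) *
    (p ^ n * (1 - fps_X * fps_deriv p * inverse p))) $ n"
proof -
  define f q where "f = fps_X * inverse p" and "q = 1 - fps_X * fps_deriv p * inverse p"
  have "(f ^ j * (p ^ n * q)) $ n = (if j = n then 1 else 0)" if "j \<le> n" for j
  proof -
    have "inverse p * p = 1"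
      using p0 by (rule inverse_mult_eq_1)
    then have "inverse p ^ j * p ^ j = 1"
      by (metis power_mult_distrib power_one)
    moreover have "p ^ n = p ^ j * p ^ (n - j)"
      using that by (simp flip: power_add)
    ultimately have eq: "f ^ j * (p ^ n * q) = fps_X ^ j * (p ^ (n - j) * q)"
      by (simp add: f_def power_mult_distrib)
    show ?thesis
      unfolding eq using that fps_nth_power_mult_log_deriv[OF p0, of "n - j"]
      by (auto simp: fps_X_power_mult_nth q_def)
  qed
  then have "((b oo f) * (p ^ n * q)) $ n = (\<Sum>j=0..n. if j = n then b $ j else 0)"
    by (subst fps_nth_compose_mult) (simp_all add: f_def if_distrib[of "(*) _"] cong: if_cong)
  then show ?thesis
    by (simp add: f_def q_def)
qed

section \<open>The generating function of the coefficients\<close>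

definition sqrt_trinomial :: "real fps" where
  "sqrt_trinomial = fps_binomial (1 / 2) oo (fps_X + fps_X\<^sup>2)"

lemma sqrt_trinomial_nth_0 [simp]: "sqrt_trinomial $ 0 = 1"
  by (simp add: sqrt_trinomial_def)

lemma sqrt_trinomial_power:
  "sqrt_trinomial ^ m = fps_binomial (real m / 2) oo (fps_X + fps_X\<^sup>2)"
  by (simp add: sqrt_trinomial_def fps_binomial_power fps_compose_power)

lemma sqrt_trinomial_square: "sqrt_trinomial\<^sup>2 = 1 + fps_X + fps_X\<^sup>2"
  by (simp add: sqrt_trinomial_power fps_binomial_1 fps_compose_add_distrib)

lemma mu_eq_sqrt_trinomial:
  "mu k n = sqrt_trinomial ^ ((k + 1) * n + 1) $ n / real ((k + 1) * n + 1)"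
proof -
  define m where "m = (k + 1) * n + 1"
  have coeff: "(fps_X + fps_X\<^sup>2 :: real fps) ^ j $ n = real (j choose (n - j))" if "j \<le> n" for j
  proof -
    have "(fps_X + fps_X\<^sup>2 :: real fps) ^ j = fps_X ^ j * fps_binomial (of_nat j)"
      by (simp add: fps_binomial_of_nat power2_eq_square algebra_simps flip: power_mult_distrib)
    then show ?thesis
      using that by (simp add: fps_X_power_mult_nth binomial_gbinomial)
  qed
  have "sqrt_trinomial ^ m $ n = (\<Sum>j=0..n. (real m / 2 gchoose j) * real (j choose (n - j)))"
    by (simp add: sqrt_trinomial_power fps_compose_nth coeff)
  also have "\<dots> = (\<Sum>i=0..n. (real m / 2 gchoose (n - i)) * real ((n - i) choose i))"
    by (subst sum.atLeastAtMost_rev) simp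
  \<comment> \<open>Past \<open>n div 2\<close> the lower index \<open>i\<close> exceeds
    \<open>n - i\<close>.\<close>
  also have "\<dots> = (\<Sum>i=0..n div 2. (real m / 2 gchoose (n - i)) * real ((n - i) choose i))"
    by (intro sum.mono_neutral_right) auto
  finally have "sqrt_trinomial ^ m $ n =
      (\<Sum>i=0..n div 2. (real m / 2 gchoose (n - i)) * real ((n - i) choose i))" .
  moreover have "real m = (real k + 1) * real n + 1"
    by (simp add: m_def algebra_simps)
  ultimately show ?thesis
    unfolding mu_def m_def[symmetric] by (simp add: binomial_gbinomial)
qed

text \<open>Lagrange inversion identifies \<open>B\<close> with \<open>r oo w\<close>, where
  \<open>w\<close> is the compositional inverse of \<open>fps_X / r ^ (k + 1)\<close>. Then
  \<open>f oo w = fps_X\<close> reads \<open>w = fps_X * B ^ (k + 1)\<close>, and composing the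
  formula for \<open>r\<^sup>2\<close> with \<open>w\<close> gives the equation.\<close>

lemma mu_fps_equation:
  fixes k :: nat
  defines "B \<equiv> Abs_fps (mu k)"
  shows "B\<^sup>2 = 1 + fps_X * B ^ (k + 1) + (fps_X * B ^ (k + 1))\<^sup>2"
proof -
  define r where "r = sqrt_trinomial"
  define p where "p = r ^ (k + 1)"
  define f where "f = fps_X * inverse p"
  define w where "w = fps_inv f"
  have p0: "p $ 0 = 1" and r0: "r $ 0 = 1"
    by (simp_all add: p_def r_def fps_nth_power_0)
  have f0: "f $ 0 = 0" and f1: "f $ 1 \<noteq> 0"
    by (simp_all add: f_def p0)
  have w0: "w $ 0 = 0"
    by (simp add: w_def fps_inv_def)
  have "(r oo w) oo f = r"
    using fps_inv[OF f0 f1] by (simp add: w_def[symmetric] fps_compose_assoc[OF f0 w0, symmetric])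
  then have compose: "(r oo w) $ n = (r * (p ^ n * (1 - fps_X * fps_deriv p * inverse p))) $ n" for n
    using fps_Lagrange_inversion[of p "r oo w" n] p0 by (simp add: f_def)
  have "(r oo w) $ n = mu k n" for n
  proof -
    define m where "m = (k + 1) * n + 1"
    have rp: "inverse p * p = 1"
      using p0 by (intro inverse_mult_eq_1) simp
    have m: "r * p ^ n = r ^ m"
      unfolding p_def m_def power_mult[symmetric] by simp
    have drm: "fps_deriv (r ^ m) = of_nat m * (fps_deriv r * r ^ ((k + 1) * n))"
      unfolding fps_deriv_power' by (simp add: m_def mult_ac)
    have dp: "fps_deriv p = of_nat (k + 1) * (fps_deriv r * r ^ k)"
      unfolding p_def fps_deriv_power' by (simp add: mult_ac)
    have "p ^ n = r ^ ((k + 1) * n)"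
      by (simp only: p_def power_mult)
    then have "of_nat m * (r * p ^ n * fps_deriv p) = of_nat (k + 1) * (p * fps_deriv (r ^ m))"
      unfolding drm dp by (simp add: p_def mult_ac)
    then have "of_nat m * (r * p ^ n * fps_deriv p) * (fps_X * inverse p) =
        of_nat (k + 1) * (p * fps_deriv (r ^ m)) * (fps_X * inverse p)"
      by simp
    also have "\<dots> = of_nat (k + 1) * (fps_X * fps_deriv (r ^ m)) * (inverse p * p)"
      by (simp only: mult_ac)
    finally have "of_nat m * (r * (p ^ n * (1 - fps_X * fps_deriv p * inverse p)))
       = of_nat m * r ^ m - of_nat (k + 1) * (fps_X * fps_deriv (r ^ m))"
      unfolding m[symmetric] rp by (simp add: right_diff_distrib mult_ac)
    then have "(of_nat m * (r * (p ^ n * (1 - fps_X * fps_deriv p * inverse p)))) $ n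
       = (of_nat m * r ^ m - of_nat (k + 1) * (fps_X * fps_deriv (r ^ m))) $ n"
      by simp
    then have "real m * (r oo w) $ n = real m * r ^ m $ n - real (k + 1) * (real n * r ^ m $ n)"
      unfolding compose fps_of_nat[symmetric] fps_sub_nth fps_mult_left_const_nth
      by (cases n) auto
    \<comment> \<open>The factor that remains is \<open>m - (k + 1) * n = 1\<close>.\<close>
    also have "\<dots> = r ^ m $ n"
      by (simp add: m_def algebra_simps)
    finally have "real m * (r oo w) $ n = r ^ m $ n" .
    moreover have "m > 0"
      by (simp add: m_def)
    ultimately show ?thesis
      unfolding mu_eq_sqrt_trinomial m_def[symmetric] r_def[symmetric] by (simp add: field_simps)
  qed
  then have B: "B = r oo w"
    by (simp add: B_def fps_eq_iff)
  have "f oo w = fps_X"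
    using fps_inv_right[OF f0 f1] by (simp add: w_def)
  moreover have "f oo w = w * inverse (B ^ (k + 1))"
    using w0 p0 by (simp add: f_def fps_compose_mult_distrib fps_inverse_compose B p_def
        fps_compose_power del: power_Suc)
  moreover have "inverse (B ^ (k + 1)) * B ^ (k + 1) = 1"
    by (intro inverse_mult_eq_1) (simp add: B r0)
  ultimately have "w = fps_X * B ^ (k + 1)"
    by (metis mult.assoc mult_1_right)
  moreover have "B\<^sup>2 = 1 + w + w\<^sup>2"
    unfolding B fps_compose_power[OF w0] r_def sqrt_trinomial_square
    using w0 by (simp add: fps_compose_add_distrib flip: fps_compose_power)
  ultimately show ?thesis
    by simp
qed

section \<open>The kernel method\<close>

text \<open>Substitute \<open>c ^ (k + 1)\<close> for the variable in the equation of
  \<open>B\<close> and multiply by \<open>c\<^sup>2\<close>. The series \<open>c\<close> is kept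
  general to serve for both \<open>fps_X\<close> and \<open>- fps_X\<close>.\<close>

lemma kernel_root:
  fixes k :: nat and c :: "real fps"
  assumes c0: "c $ 0 = 0"
  defines "u \<equiv> c * (Abs_fps (mu k) oo c ^ (k + 1))"
  shows "u\<^sup>2 = c\<^sup>2 * (1 + u ^ (k + 1) + u ^ (2 * k + 2))"
proof -
  define b where "b = Abs_fps (mu k) oo c ^ (k + 1)"
  have y0: "(c ^ (k + 1)) $ 0 = 0"
    using c0 by simp
  have "b\<^sup>2 = (1 + fps_X * Abs_fps (mu k) ^ (k + 1) + (fps_X * Abs_fps (mu k) ^ (k + 1))\<^sup>2)
      oo c ^ (k + 1)"
    unfolding b_def fps_compose_power[OF y0] mu_fps_equation ..
  also have "\<dots> = 1 + c ^ (k + 1) * b ^ (k + 1) + (c ^ (k + 1) * b ^ (k + 1))\<^sup>2"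
    using y0 by (simp add: fps_compose_add_distrib fps_compose_mult_distrib
        fps_compose_power[symmetric] b_def del: power_Suc)
  also have "\<dots> = 1 + u ^ (k + 1) + (u ^ (k + 1))\<^sup>2"
    by (simp only: u_def b_def power_mult_distrib)
  also have "(u ^ (k + 1))\<^sup>2 = u ^ (2 * k + 2)"
    by (simp only: flip: power_mult) (simp add: algebra_simps)
  finally show ?thesis
    by (simp add: u_def b_def power_mult_distrib)
qed

text \<open>This is \<open>(u ^ j - v ^ j) / (u - v)\<close> written without division: the complete
  homogeneous symmetric polynomial of degree \<open>j - 1\<close> in \<open>u\<close> and
  \<open>v\<close>.\<close>

definition power_diff_quotient :: "'a :: comm_ring_1 \<Rightarrow> 'a \<Rightarrow> nat \<Rightarrow> 'a" where
  "power_diff_quotient u v j = (\<Sum>i<j. v ^ (j - Suc i) * u ^ i)"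

lemma mult_power_diff_quotient: "(u - v) * power_diff_quotient u v j = u ^ j - v ^ j"
  by (simp add: power_diff_quotient_def power_diff_sumr2)

lemma power_diff_quotient_simps [simp]:
  "power_diff_quotient u v 0 = 0" "power_diff_quotient u v (Suc 0) = 1"
  by (simp_all add: power_diff_quotient_def)

text \<open>For \<open>h \<ge> 2\<close> the recurrence is a linear combination of the two kernel
  equations. For \<open>h = 1\<close> the missing down step agrees with \<open>D 0 = 0\<close>. For
  \<open>h = 0\<close> the product \<open>u * v\<close> supplies the constant 1.\<close>

lemma kernel_recurrence:
  fixes u v t C :: "'a :: idom"
  assumes u: "u\<^sup>2 = t * (1 + u ^ (k + 1) + u ^ (2 * k + 2))"
    and v: "v\<^sup>2 = t * (1 + v ^ (k + 1) + v ^ (2 * k + 2))"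
    and uv: "u * v = - t * C" and "u \<noteq> v" and "t \<noteq> 0"
  defines "F \<equiv> \<lambda>h. C * power_diff_quotient u v (h + 1)"
  assumes "k > 0"
  shows "F h = (if h = 0 then 1 else 0) +
    t * (F (h + 2 * k) + F (h + k - 1) + (if h < 2 then 0 else F (h - 2)))"
proof -
  define D where "D = power_diff_quotient u v"
  have D: "(u - v) * D j = u ^ j - v ^ j" for j
    by (simp add: D_def mult_power_diff_quotient)
  have D01: "D 0 = 0" "D 1 = 1"
    by (simp_all add: D_def)
  have step: "D (j + 2) = t * (D (j + 2 * k + 2) + D (j + k + 1) + D j)" for j
  proof -
    have "u ^ j * u\<^sup>2 = t * (u ^ j + u ^ (j + k + 1) + u ^ (j + 2 * k + 2))"
      unfolding u by (simp add: power_add algebra_simps)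
    moreover have "v ^ j * v\<^sup>2 = t * (v ^ j + v ^ (j + k + 1) + v ^ (j + 2 * k + 2))"
      unfolding v by (simp add: power_add algebra_simps)
    ultimately have "(u - v) * D (j + 2) =
        (u - v) * (t * (D (j + 2 * k + 2) + D (j + k + 1) + D j))"
      unfolding distrib_left mult.left_commute[of "u - v"] D
      by (simp add: power_add algebra_simps power2_eq_square)
    then show ?thesis
      using \<open>u \<noteq> v\<close> by simp
  qed
  \<comment> \<open>Formally this is \<open>step\<close> at \<open>j = -1\<close>: there
    \<open>D (-1) = -1 / (u * v) = 1 / (t * C)\<close>, so the last term contributes 1 after
    multiplication by \<open>C\<close>.\<close>
  have start: "C = 1 + t * (C * D (2 * k + 1) + C * D k)"
  proof -
    define U V where "U = u ^ (2 * k + 1) + u ^ k" and "V = v ^ (2 * k + 1) + v ^ k"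
    have "t * (u * U) = u\<^sup>2 - t"
      unfolding u U_def by (simp add: algebra_simps)
    moreover have "t * (v * V) = v\<^sup>2 - t"
      unfolding v V_def by (simp add: algebra_simps)
    moreover have "(u - v) * (D (2 * k + 1) + D k) = U - V"
      unfolding distrib_left D by (simp add: U_def V_def)
    ultimately have "t * (u - v) * C = t * (u - v) * (1 + t * (C * D (2 * k + 1) + C * D k))"
      using uv by algebra
    then show ?thesis
      using \<open>u \<noteq> v\<close> \<open>t \<noteq> 0\<close> by simp
  qed
  have F: "F h = C * D (h + 1)" for h
    by (simp add: F_def D_def)
  consider "h = 0" | "h = 1" | j where "h = j + 2"
    by (metis One_nat_def add_2_eq_Suc' not0_implies_Suc)
  then show ?thesis
  proof cases
    case 1
    then show ?thesis
      using start D01 \<open>k > 0\<close> by (simp add: F)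
  next
    case 2
    then show ?thesis
      using step[of 0] D01 by (simp add: F algebra_simps numeral_2_eq_2)
  next
    case 3
    then show ?thesis
      using step[of "j + 1"] by (simp add: F algebra_simps)
  qed
qed

section \<open>Counting paths from a given height\<close>

text \<open>A free start height makes the family closed under removal of the first step. Heights are
  integers, so that a step below the axis simply leads to an empty set.\<close>

definition paths_from :: "nat \<Rightarrow> nat \<Rightarrow> int \<Rightarrow> (int \<times> int) list set" where
  "paths_from k N h = {p. set p \<subseteq> motzkin_steps k \<and> length p = N \<and>
     h + snd (vertex p N) = 0 \<and> (\<forall>j\<le>N. 0 \<le> h + snd (vertex p j))}"

lemma vertex_0 [simp]: "vertex p 0 = 0"
  by (simp add: vertex_def)

lemma vertex_Cons_Suc [simp]: "vertex (s # p) (Suc j) = s + vertex p j"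
  by (simp add: vertex_def)

lemma finite_paths_from: "finite (paths_from k N h)"
proof (rule finite_subset)
  show "paths_from k N h \<subseteq> {p. set p \<subseteq> motzkin_steps k \<and> length p = N}"
    by (auto simp: paths_from_def)
  show "finite {p. set p \<subseteq> motzkin_steps k \<and> length p = N}"
    by (intro finite_lists_length_eq) (simp add: motzkin_steps_def)
qed

lemma paths_from_neg: "h < 0 \<Longrightarrow> paths_from k N h = {}"
  by (auto simp: paths_from_def)

lemma paths_from_0: "paths_from k 0 h = (if h = 0 then {[]} else {})"
  by (auto simp: paths_from_def)

lemma Cons_in_paths_from:
  assumes "h \<ge> 0"
  shows "s # p \<in> paths_from k (Suc N) h \<longleftrightarrow>
    s \<in> motzkin_steps k \<and> p \<in> paths_from k N (h + snd s)"
proof -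
  have "(\<forall>j\<le>Suc N. 0 \<le> h + snd (vertex (s # p) j)) \<longleftrightarrow> (\<forall>j\<le>N. 0 \<le> h + snd s + snd (vertex p j))"
    using assms by (auto simp: All_less_Suc2 add.assoc simp flip: less_Suc_eq_le)
  then show ?thesis
    by (auto simp: paths_from_def add.assoc)
qed

lemma card_paths_from_Suc:
  assumes "h \<ge> 0"
  shows "card (paths_from k (Suc N) h) = card (paths_from k N (h + 2 * int k)) +
    card (paths_from k N (h + int k - 1)) + card (paths_from k N (h - 2))"
proof -
  have "paths_from k (Suc N) h = (\<Union>s\<in>motzkin_steps k. Cons s ` paths_from k N (h + snd s))"
  proof (rule set_eqI)
    fix q
    show "q \<in> paths_from k (Suc N) h \<longleftrightarrow>
        q \<in> (\<Union>s\<in>motzkin_steps k. Cons s ` paths_from k N (h + snd s))"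
      using Cons_in_paths_from[OF assms] by (cases q) (auto simp: paths_from_def)
  qed
  then have "card (paths_from k (Suc N) h) =
      (\<Sum>s\<in>motzkin_steps k. card (Cons s ` paths_from k N (h + snd s)))"
    by (simp, intro card_UN_disjoint) (auto simp: motzkin_steps_def finite_paths_from)
  also have "\<dots> = (\<Sum>s\<in>motzkin_steps k. card (paths_from k N (h + snd s)))"
    by (simp add: card_image)
  \<comment> \<open>The three steps are distinct because \<open>k\<close> is nonnegative.\<close>
  also have "\<dots> = card (paths_from k N (h + 2 * int k)) +
      card (paths_from k N (h + int k - 1)) + card (paths_from k N (h - 2))"
    by (simp add: motzkin_steps_def add_diff_eq)
  finally show ?thesis .
qed

lemma fst_sum_list_motzkin_steps:
  "set p \<subseteq> motzkin_steps k \<Longrightarrow> fst (sum_list p) = int (length p)"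
  by (induction p) (auto simp: motzkin_steps_def)

text \<open>Each step advances the abscissa by 1, so the end abscissa is the number of
  steps.\<close>

lemma motzkin_paths_eq_paths_from: "motzkin_paths k n = paths_from k ((k + 1) * n) 0"
proof -
  have "vertex p (length p) = ((int k + 1) * int n, 0) \<longleftrightarrow>
      length p = (k + 1) * n \<and> snd (vertex p (length p)) = 0" if "set p \<subseteq> motzkin_steps k" for p
  proof -
    have "(int k + 1) * int n = int ((k + 1) * n)"
      by (simp add: algebra_simps)
    then show ?thesis
      using fst_sum_list_motzkin_steps[OF that]
      by (auto simp: vertex_def prod_eq_iff simp del: of_nat_mult of_nat_add)
  qed
  then show ?thesis
    unfolding motzkin_paths_def paths_from_def add_0 by (intro Collect_cong) metis
qed

text \<open>The factor \<open>fps_X\<^sup>2\<close> marks one step: the recurrence expresses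
  coefficients at \<open>2 * Suc N\<close> by those at \<open>2 * N\<close>, just as splitting off
  the first step does for the paths.\<close>

lemma card_paths_from_eq_coeff:
  fixes F :: "nat \<Rightarrow> real fps"
  assumes F: "\<And>h. F h = (if h = 0 then 1 else 0) +
      fps_X\<^sup>2 * (F (h + 2 * k) + F (h + k - 1) + (if h < 2 then 0 else F (h - 2)))"
    and "k > 0"
  shows "real (card (paths_from k N (int h))) = F h $ (2 * N)"
proof (induction N arbitrary: h)
  case 0
  show ?case
    by (subst F) (simp add: paths_from_0)
next
  case (Suc N)
  have "F h $ (2 * Suc N) =
      F (h + 2 * k) $ (2 * N) + F (h + k - 1) $ (2 * N) + (if h < 2 then 0 else F (h - 2) $ (2 * N))"
    by (subst F) (simp add: fps_X_power_mult_nth)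
  also have "\<dots> = real (card (paths_from k N (int h + 2 * int k)) +
      card (paths_from k N (int h + int k - 1)) + card (paths_from k N (int h - 2)))"
  proof -
    \<comment> \<open>Positivity of \<open>k\<close> keeps the natural subtraction in
      \<open>h + k - 1\<close> exact, even at \<open>h = 0\<close>.\<close>
    have "int (h + 2 * k) = int h + 2 * int k" "int (h + k - 1) = int h + int k - 1"
      using \<open>k > 0\<close> by (simp_all add: of_nat_diff)
    moreover have "real (card (paths_from k N (int h - 2))) =
        (if h < 2 then 0 else F (h - 2) $ (2 * N))"
      by (simp add: paths_from_neg of_nat_diff flip: Suc.IH)
    ultimately show ?thesis
      unfolding Suc.IH[symmetric] by simp
  qed
  finally show ?case
    by (simp add: card_paths_from_Suc)
qed

lemma fps_compose_X_power_nth: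
  fixes a :: "'a :: comm_ring_1 fps"
  assumes "m > 0"
  shows "(a oo fps_X ^ m) $ (m * j) = a $ j"
proof -
  have "(a oo fps_X ^ m) $ (m * j) = (\<Sum>i=0..m*j. if i = j then a $ i else 0)"
    using assms unfolding fps_compose_nth power_mult[symmetric]
    by (intro sum.cong refl) (auto simp: fps_X_power_nth)
  then show ?thesis
    using assms by simp
qed

theorem theorem5p3:
  fixes n k :: nat
  assumes "even k" and "k > 0"
  shows "real (card (motzkin_paths k n)) =
    (\<Sum>i = 0..2 * n. (- 1) ^ i * mu k i * mu k (2 * n - i))"
proof -
  define B where "B = Abs_fps (mu k)"
  define X where "X = (fps_X :: real fps)"
  define u v where "u = X * (B oo X ^ (k + 1))" and "v = - X * (B oo (- X) ^ (k + 1))"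
  define C where "C = (B oo (- X) ^ (k + 1)) * (B oo X ^ (k + 1))"
  define F where "F = (\<lambda>h. C * power_diff_quotient u v (h + 1))"
  have u: "u\<^sup>2 = X\<^sup>2 * (1 + u ^ (k + 1) + u ^ (2 * k + 2))"
    unfolding u_def B_def by (rule kernel_root) (simp add: X_def)
  have v: "v\<^sup>2 = X\<^sup>2 * (1 + v ^ (k + 1) + v ^ (2 * k + 2))"
    using kernel_root[of "- X" k] by (simp add: X_def v_def B_def)
  have uv: "u * v = - X\<^sup>2 * C"
    by (simp add: u_def v_def C_def power2_eq_square)
  have "mu k 0 = 1"
    by (simp add: mu_def)
  then have "u $ 1 = 1" "v $ 1 = - 1"
    by (simp_all add: u_def v_def X_def B_def)
  then have "u \<noteq> v"
    by auto
  then have "F h = (if h = 0 then 1 else 0) +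
      X\<^sup>2 * (F (h + 2 * k) + F (h + k - 1) + (if h < 2 then 0 else F (h - 2)))" for h
    unfolding F_def using \<open>k > 0\<close> by (intro kernel_recurrence[OF u v uv]) (simp_all add: X_def)
  then have "real (card (paths_from k ((k + 1) * n) (int 0))) = F 0 $ (2 * ((k + 1) * n))"
    using \<open>k > 0\<close> unfolding X_def by (intro card_paths_from_eq_coeff)
  \<comment> \<open>Here \<open>F 0 = C\<close>. Evenness of \<open>k\<close> gives
    \<open>(- X) ^ (k + 1) = - (X ^ (k + 1))\<close>, so both factors of \<open>C\<close> are series
    in \<open>X ^ (k + 1)\<close>.\<close>
  also have "F 0 = ((B oo - X) * B) oo X ^ (k + 1)"
  proof -
    have "(B oo - X) oo X ^ (k + 1) = B oo (- X oo X ^ (k + 1))"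
      by (intro fps_compose_assoc[symmetric]) (simp_all add: X_def)
    also have "- X oo X ^ (k + 1) = (- X) ^ (k + 1)"
      using \<open>even k\<close> by (simp add: X_def fps_compose_uminus)
    finally show ?thesis
      by (simp add: F_def C_def X_def fps_compose_mult_distrib del: power_Suc)
  qed
  also have "\<dots> $ (2 * ((k + 1) * n)) = ((B oo - X) * B) $ (2 * n)"
    using fps_compose_X_power_nth[of "k + 1" "(B oo - X) * B" "2 * n"]
    by (simp only: X_def mult.left_commute[of 2])
  \<comment> \<open>The coefficients of \<open>B oo - X\<close> are
    \<open>(- 1) ^ i * mu k i\<close>; the sum is the Cauchy product.\<close>
  also have "\<dots> = (\<Sum>i = 0..2 * n. (- 1) ^ i * mu k i * mu k (2 * n - i))"
    by (simp add: fps_mult_nth B_def X_def fps_compose_uminus')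
  finally show ?thesis
    by (simp add: motzkin_paths_eq_paths_from)
qed

end
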